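(* The function $h:\mathbb{R}\to[-\infty,\infty)$ is decreasing in $C$; that is, if $C<C'$ then $h(C)\ge h(C')$.
   Context: Let $X\subset\mathbb{R}^d$ be open and bounded, let $Y=\{y_1,\dots,y_N\}\subset\mathbb{R}$ be finite, and let $c\in C^2(X\times Y)$ satisfy $D_xc(x,y_{i+1})-D_xc(x,y_i)\neq 0$ for all $x\in X$ and $1\le i\le N-1$. Let $\mu\in\mathcal{P}(X)$ be a fixed probability measure. The function $f:[0,\infty)\to\mathbb{R}$ is continuously differentiable on $(0,\infty)$, strictly convex, has superlinear growth, and satisfies $\lim_{s\to0^+}f'(s)=-\infty$. For $1\le i\le N-1$ and $k\in\mathbb{R}$ put $X^N_{=}(y_i,k)=\{x\in X: c(x,y_{i+1})-c(x,y_i)=k\}$ and $X^N_{\ge}(y_i,k)=\{x\in X: c(x,y_{i+1})-c(x,y_i)\ge k\}$. It is assumed that $\mu(X^N_{=}(y_i,k))=0$ for all $i$ and $k$. For $1\le i\le N-2$ set $k_{\max}(y_i,k_i)=\sup\{k\in\mathbb{R}: X^N_{\ge}(y_i,k_i)\subseteq X^N_{\ge}(y_{i+1},k)\}$. Construction of $h(C)$, for $C\in\mathbb{R}$. Set $v_1^C=0$ and $X_1(v^C)=X^N_{\ge}(y_1,k_1)$, with $k_1$ such that $\mu(X^N_{\ge}(y_1,k_1))=\min\{1,(f')^{-1}(C-v_1^C)\}$. Then for each $i\ge2$ set $v_i^C=v_{i-1}^C+k_{i-1}$ and define $\overline{k}_i$ such that $$\mu(X^N_{\ge}(y_i,\overline{k}_i))=(f')^{-1}(C-v_i^C)+\sum_{j=1}^{i-1}\mu(X_j(v^C)).$$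 If $\overline{k}_i<k_{\max}(y_{i-1},k_{i-1})$ set $k_i=\overline{k}_i$; otherwise set $k_i=k_{\max}(y_{i-1},k_{i-1})$. Put $X_i(v^C)=X^N_{\ge}(y_i,k_i)\setminus X^N_{\ge}(y_{i-1},k_{i-1})$. The process continues until the index $$m^C=\max\{i: 1-\mu(X^N_{\ge}(y_{i-2},k_{i-2}))\ge (f')^{-1}(C-v_{i-1}^C)\}\le N,$$ where the indices $2\le i\le N$ are considered successively as the construction proceeds, $X^N_{\ge}(y_0,k_0):=\emptyset$, and $m^C=1$ if the inequality already fails for $i=2$. At that point one sets $X_{m^C}(v^C)=X\setminus X^N_{\ge}(y_{m^C-1},k_{m^C-1})$ and $X_i(v^C)=\emptyset$ for all $i>m^C$. If $m^C<N$, set $h(C)=-\infty$; otherwise set $$h(C)=1-\mu(X^N_{\ge}(y_{N-1},k_{N-1}))-(f')^{-1}(C-v_N^C).$$ *)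

theory Defs
  imports "HOL-Probability.Probability"
begin

definition C2_on :: "('a::euclidean_space \<Rightarrow> real) \<Rightarrow> 'a set \<Rightarrow> bool" where
  "C2_on g X \<longleftrightarrow>
     (\<exists>(g' :: 'a \<Rightarrow> ('a \<Rightarrow>\<^sub>L real)) (g'' :: 'a \<Rightarrow> ('a \<Rightarrow>\<^sub>L ('a \<Rightarrow>\<^sub>L real))).
        (\<forall>x\<in>X. (g has_derivative blinfun_apply (g' x)) (at x)) \<and>
        (\<forall>x\<in>X. (g' has_derivative blinfun_apply (g'' x)) (at x)) \<and>
        continuous_on X g'')"

definition strictly_convex_on :: "real set \<Rightarrow> (real \<Rightarrow> real) \<Rightarrow> bool" where
  "strictly_convex_on S f \<longleftrightarrow> convex S \<and>
     (\<forall>a\<in>S. \<forall>b\<in>S. \<forall>t. a \<noteq> b \<longrightarrow> 0 < t \<longrightarrow> t < 1 \<longrightarrow>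
        f ((1 - t) * a + t * b) < (1 - t) * f a + t * f b)"

text \<open>
  The inverse of \<open>f'\<close>, a bijection from \<open>(0,\<infinity>)\<close> onto the reals, extended to the
  two infinite arguments by its limits there.
\<close>

definition deriv_inv :: "(real \<Rightarrow> real) \<Rightarrow> ereal \<Rightarrow> ereal" where
  "deriv_inv f t =
     (if t = \<infinity> then \<infinity> else if t = -\<infinity> then 0
      else ereal (the_inv_into {0<..} (deriv f) (real_of_ereal t)))"

text \<open>
  The points of \<open>Y\<close> are \<open>y 1, \<dots>, y N\<close>, and the sets attached to \<open>y i\<close> are indexed by \<open>i\<close>.
\<close>

definition X_eq ::
  "'a set \<Rightarrow> ('a \<Rightarrow> real \<Rightarrow> real) \<Rightarrow> (nat \<Rightarrow> real) \<Rightarrow> nat \<Rightarrow> real \<Rightarrow> 'a set" where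
  "X_eq X c y i k = {x \<in> X. c x (y (Suc i)) - c x (y i) = k}"

text \<open>
  Since \<open>c\<close> may be unbounded on \<open>X\<close>, there need not be a real level with the prescribed
  mass, and the supremum defining \<open>k_max\<close> may be infinite. Levels are therefore
  extended reals; the level \<open>-\<infinity>\<close> gives all of \<open>X\<close>. Index \<open>0\<close> encodes the convention that
  the superlevel set belonging to \<open>y 0\<close> is empty.
\<close>

definition X_ge ::
  "'a set \<Rightarrow> ('a \<Rightarrow> real \<Rightarrow> real) \<Rightarrow> (nat \<Rightarrow> real) \<Rightarrow> nat \<Rightarrow> ereal \<Rightarrow> 'a set" where
  "X_ge X c y i k =
     (if i = 0 then {} else {x \<in> X. ereal (c x (y (Suc i)) - c x (y i)) \<ge> k})"

definition k_max ::
  "'a set \<Rightarrow> ('a \<Rightarrow> real \<Rightarrow> real) \<Rightarrow> (nat \<Rightarrow> real) \<Rightarrow> nat \<Rightarrow> ereal \<Rightarrow> ereal" where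
  "k_max X c y i k = Sup {ereal l |l. X_ge X c y i k \<subseteq> X_ge X c y (Suc i) (ereal l)}"

definition cell ::
  "'a set \<Rightarrow> ('a \<Rightarrow> real \<Rightarrow> real) \<Rightarrow> (nat \<Rightarrow> real) \<Rightarrow> (nat \<Rightarrow> ereal) \<Rightarrow> nat \<Rightarrow> nat \<Rightarrow> 'a set" where
  "cell X c y k m i =
     (if i < m then X_ge X c y i (k i) - X_ge X c y (i - 1) (k (i - 1))
      else if i = m then X - X_ge X c y (m - 1) (k (m - 1))
      else {})"

text \<open>
  A run of the construction at \<open>C\<close> that stops at index \<open>m\<close>, with levels \<open>k\<close>, auxiliary levels
  \<open>kb\<close> and potential \<open>v\<close>. The levels need not be uniquely determined by the masses they
  prescribe, hence a relation rather than a function. The last two conjuncts say that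
  the stopping test is passed at the indices \<open>2, \<dots>, m\<close> and fails at \<open>m + 1\<close> unless \<open>m = N\<close>.
\<close>

definition construction ::
  "'a set \<Rightarrow> nat \<Rightarrow> (nat \<Rightarrow> real) \<Rightarrow> ('a \<Rightarrow> real \<Rightarrow> real) \<Rightarrow> 'a measure \<Rightarrow> (real \<Rightarrow> real) \<Rightarrow>
   real \<Rightarrow> nat \<Rightarrow> (nat \<Rightarrow> ereal) \<Rightarrow> (nat \<Rightarrow> ereal) \<Rightarrow> (nat \<Rightarrow> ereal) \<Rightarrow> bool" where
  "construction X N y c \<mu> f C m kb k v \<longleftrightarrow>
     1 \<le> m \<and> m \<le> N \<and>
     v 1 = 0 \<and> (\<forall>i\<in>{2..m}. v i = v (i - 1) + k (i - 1)) \<and>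
     (1 < N \<longrightarrow>
        ereal (measure \<mu> (X_ge X c y 1 (k 1))) = min 1 (deriv_inv f (ereal C - v 1))) \<and>
     (\<forall>i\<in>{2..<m}.
        ereal (measure \<mu> (X_ge X c y i (kb i))) =
          deriv_inv f (ereal C - v i) +
          ereal (\<Sum>j=1..i-1. measure \<mu> (cell X c y k m j)) \<and>
        k i = (if kb i < k_max X c y (i - 1) (k (i - 1)) then kb i
               else k_max X c y (i - 1) (k (i - 1)))) \<and>
     (\<forall>i\<in>{2..m}.
        ereal (1 - measure \<mu> (X_ge X c y (i - 2) (k (i - 2))))
          \<ge> deriv_inv f (ereal C - v (i - 1))) \<and>
     (m < N \<longrightarrow>
        \<not> ereal (1 - measure \<mu> (X_ge X c y (m - 1) (k (m - 1))))
          \<ge> deriv_inv f (ereal C - v m))"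

definition h_value ::
  "'a set \<Rightarrow> nat \<Rightarrow> (nat \<Rightarrow> real) \<Rightarrow> ('a \<Rightarrow> real \<Rightarrow> real) \<Rightarrow> 'a measure \<Rightarrow> (real \<Rightarrow> real) \<Rightarrow>
   real \<Rightarrow> ereal \<Rightarrow> bool" where
  "h_value X N y c \<mu> f C r \<longleftrightarrow>
     (\<exists>m kb k v. construction X N y c \<mu> f C m kb k v \<and>
        r = (if m < N then -\<infinity>
             else ereal (1 - measure \<mu> (X_ge X c y (N - 1) (k (N - 1))))
                    - deriv_inv f (ereal C - v N)))"


lemma deriv_inv_props:
  assumes f_diff: "\<forall>s>0. f differentiable at s" "continuous_on {0<..} (deriv f)"
    and f_convex: "strictly_convex_on {0..} f"
    and f_superlinear: "filterlim (\<lambda>s. f s / s) at_top at_top"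
    and f_deriv_0: "filterlim (deriv f) at_bot (at_right 0)"
  shows "bij_betw (deriv f) {0<..} UNIV" "strict_mono_on {0<..} (deriv f)"
proof -
  have D: "(f has_real_derivative deriv f s) (at s)" if "s > 0" for s
    using f_diff(1) that by (metis DERIV_deriv_iff_real_differentiable)
  have sc: "f ((1 - t) * a + t * b) < (1 - t) * f a + t * f b"
    if "0 \<le> a" "0 \<le> b" "a \<noteq> b" "0 < t" "t < 1" for a b t
    using f_convex that unfolding strictly_convex_on_def by auto
  have "convex_on {0<..} f"
  proof (rule convex_onI)
    fix t x y :: real assume *: "0 < t" "t < 1" "x \<in> {0<..}" "y \<in> {0<..}"
    show "f ((1 - t) *\<^sub>R x + t *\<^sub>R y) \<le> (1 - t) * f x + t * f y"
    proof (cases "x = y")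
      case True then show ?thesis by (simp add: algebra_simps)
    next
      case False then show ?thesis using sc[of x y t] * by simp
    qed
  qed auto
  have tan: "deriv f x * (y - x) < f y - f x" if "x > 0" "y > 0" "x \<noteq> y" for x y
  proof -
    let ?z = "(x + y) / 2"
    have "f ?z < (f x + f y) / 2" using sc[of x y "1/2"] that by (simp add: field_simps)
    moreover have "f ?z - f x \<ge> deriv f x * (?z - x)"
      by (rule convex_on_imp_above_tangent[OF \<open>convex_on {0<..} f\<close>])
        (use that D in \<open>auto intro: DERIV_subset simp: interior_open\<close>)
    ultimately show ?thesis by (simp add: field_simps)
  qed
  show sm: "strict_mono_on {0<..} (deriv f)"
  proof (rule strict_mono_onI)
    fix r s :: real assume "r \<in> {0<..}" "s \<in> {0<..}" "r < s"
    then have "deriv f r * (s - r) < f s - f r" "deriv f s * (r - s) < f r - f s"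
      using tan[of r s] tan[of s r] by auto
    then have "deriv f r * (s - r) < deriv f s * (s - r)" by (simp add: algebra_simps)
    then show "deriv f r < deriv f s" using \<open>r < s\<close> by simp
  qed
  have "\<exists>s>0. deriv f s = t" for t
  proof -
    have "eventually (\<lambda>s. deriv f s \<le> t) (at_right 0)"
      using f_deriv_0 by (simp add: filterlim_at_bot)
    then obtain e where e: "e > 0" "\<And>s. 0 < s \<Longrightarrow> s < e \<Longrightarrow> deriv f s \<le> t"
      unfolding eventually_at_right_field by blast
    define a where "a = e/2"
    have a: "a > 0" "deriv f a \<le> t" using e by (auto simp: a_def)
    define K where "K = \<bar>t\<bar> + \<bar>f 1\<bar> + 1"
    have "eventually (\<lambda>s. f s / s \<ge> K) at_top"
      using f_superlinear by (simp add: filterlim_at_top)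
    moreover have "eventually (\<lambda>s::real. s > max 2 a) at_top" by (rule eventually_gt_at_top)
    ultimately have "eventually (\<lambda>s. f s / s \<ge> K \<and> s > max 2 a) at_top"
      by eventually_elim simp
    then obtain s where s: "f s / s \<ge> K" "s > max 2 a"
      using eventually_happens trivial_limit_at_top_linorder by blast
    have "f s \<ge> K * s" using s by (simp add: field_simps)
    moreover have "deriv f s * (1 - s) < f 1 - f s" using tan[of s 1] s by simp
    ultimately have *: "deriv f s * (s - 1) > K * s - f 1" by (simp add: algebra_simps)
    have "K * s - f 1 \<ge> t * (s - 1)"
    proof -
      have "(\<bar>t\<bar> - t) * (s-1) \<ge> 0" "\<bar>f 1\<bar> * (s - 1) \<ge> 0" using s by auto
      moreover have "K * s - f 1 - t * (s - 1) =
          (\<bar>t\<bar> - t) * (s - 1) + \<bar>t\<bar> + \<bar>f 1\<bar> * (s - 1) + (\<bar>f 1\<bar> - f 1) + s"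
        by (simp add: K_def algebra_simps)
      ultimately show ?thesis using s by linarith
    qed
    then have "t * (s - 1) < deriv f s * (s - 1)" using * by linarith
    then have "deriv f s > t" using s by simp
    moreover have "continuous_on {a..s} (deriv f)"
      by (rule continuous_on_subset[OF f_diff(2)]) (use a in auto)
    ultimately show ?thesis
      using IVT'[of "deriv f" a t s] a s by (metis max_less_iff_conj less_eq_real_def less_le_trans)
  qed
  then have "t \<in> deriv f ` {0<..}" for t by (metis greaterThan_iff image_eqI)
  then have "deriv f ` {0<..} = UNIV" by (intro equalityI subsetI) auto
  then show "bij_betw (deriv f) {0<..} UNIV"
    using sm by (simp add: bij_betw_def strict_mono_on_imp_inj_on)
qed

lemma deriv_inv_pos:
  assumes "bij_betw (deriv f) {0<..} UNIV" "t \<noteq> -\<infinity>"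
  shows "deriv_inv f t > 0"
  using assms the_inv_into_into[of "deriv f" "{0<..}" "real_of_ereal t" "{0<..}"]
  by (auto simp: deriv_inv_def bij_betw_def)

lemma X_ge_measurable:
  assumes "C2_on (\<lambda>x. c x (y i)) X" "C2_on (\<lambda>x. c x (y (Suc i))) X"
    "sets \<mu> = sets (restrict_space borel X)"
  shows "(\<lambda>x. c x (y (Suc i)) - c x (y i)) \<in> borel_measurable \<mu>"
proof -
  have "continuous_on X g" if "C2_on g X" for g
    using that unfolding C2_on_def
    by (metis continuous_at_imp_continuous_on has_derivative_continuous)
  then have "continuous_on X (\<lambda>x. c x (y (Suc i)) - c x (y i))"
    using assms by (intro continuous_on_diff) auto
  then have "(\<lambda>x. c x (y (Suc i)) - c x (y i)) \<in> borel_measurable (restrict_space borel X)"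
    by (rule borel_measurable_continuous_on_restrict)
  then show ?thesis using assms(3) measurable_cong_sets by blast
qed

lemma level_ex:
  assumes "prob_space \<mu>" "space \<mu> = X" "i > 0"
    and g: "(\<lambda>x. c x (y (Suc i)) - c x (y i)) \<in> borel_measurable \<mu>"
    and null: "\<forall>k. measure \<mu> (X_eq X c y i k) = 0"
    and t: "0 < t" "t \<le> 1"
  shows "\<exists>k. k < \<infinity> \<and> measure \<mu> (X_ge X c y i k) = t"
proof (cases "t = 1")
  case True
  have "X_ge X c y i (-\<infinity>) = X" using \<open>i > 0\<close> by (auto simp: X_ge_def)
  then show ?thesis using True assms prob_space.prob_space[OF assms(1)] 
    by (metis ereal_infty_less(1) MInfty_neq_PInfty(1))
next
  case False
  define g where "g = (\<lambda>x. c x (y (Suc i)) - c x (y i))"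
  have gm: "g \<in> borel_measurable \<mu>" using g by (simp add: g_def)
  define D where "D = distr \<mu> borel g"
  interpret prob_space \<mu> by fact
  interpret D: real_distribution D unfolding D_def using gm by (rule real_distribution_distr)
  have z: "measure D {k} = 0" for k
  proof -
    have "measure D {k} = measure \<mu> (g -` {k} \<inter> space \<mu>)"
      unfolding D_def using gm by (simp add: measure_distr)
    also have "g -` {k} \<inter> space \<mu> = X_eq X c y i k"
      using assms(2) by (auto simp: X_eq_def g_def)
    finally show ?thesis using null by simp
  qed
  have cont: "isCont (cdf D) k" for k using D.isCont_cdf z by simp
  have ge: "measure \<mu> (X_ge X c y i (ereal k)) = 1 - cdf D k" for k
  proof -
    have "measure \<mu> (X_ge X c y i (ereal k)) = measure \<mu> (g -` {k..} \<inter> space \<mu>)"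
      using assms(2,3) by (auto simp: X_ge_def g_def intro!: arg_cong[where f = "measure \<mu>"])
    also have "\<dots> = measure D {k..}" unfolding D_def using gm by (simp add: measure_distr)
    also have "{k..} = {k} \<union> (space D - {..k})" by (auto simp: D_def)
    also have "measure D \<dots> = measure D {k} + measure D (space D - {..k})"
      by (rule D.finite_measure_Union) auto
    also have "\<dots> = 1 - cdf D k" using z D.prob_compl[of "{..k}"] by (simp add: cdf_def)
    finally show ?thesis .
  qed
  have "eventually (\<lambda>k. cdf D k < 1 - t) at_bot"
    using D.cdf_lim_at_bot t False by (intro order_tendstoD) auto
  moreover have "eventually (\<lambda>k. cdf D k > 1 - t) at_top"
    using D.cdf_lim_at_top_prob t False by (intro order_tendstoD) auto
  ultimately obtain a b where ab: "\<And>k. k \<le> a \<Longrightarrow> cdf D k < 1 - t" "\<And>k. k \<ge> b \<Longrightarrow> cdf D k > 1 - t"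
    unfolding eventually_at_bot_linorder eventually_at_top_linorder by metis
  have "\<exists>x\<ge>min a b. x \<le> max a b \<and> cdf D x = 1 - t"
    by (rule IVT) (use ab cont in \<open>auto simp: less_imp_le\<close>)
  then obtain k where "cdf D k = 1 - t" by blast
  then have "measure \<mu> (X_ge X c y i (ereal k)) = t" by (simp add: ge)
  then show ?thesis by (metis less_ereal.simps(4))
qed

lemma X_ge_nested:
  assumes "i > 0" "l \<le> k_max X c y i k"
  shows "X_ge X c y i k \<subseteq> X_ge X c y (Suc i) l"
proof
  fix x assume x: "x \<in> X_ge X c y i k"
  let ?d = "ereal (c x (y (Suc (Suc i))) - c x (y (Suc i)))"
  have "k_max X c y i k \<le> ?d"
    unfolding k_max_def
  proof (rule Sup_least)
    fix z assume "z \<in> {ereal l |l. X_ge X c y i k \<subseteq> X_ge X c y (Suc i) (ereal l)}"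
    then show "z \<le> ?d" using x by (auto simp: X_ge_def)
  qed
  then show "x \<in> X_ge X c y (Suc i) l" using x assms by (auto simp: X_ge_def split: if_splits)
qed


lemma cell_cong:
  assumes "j < m" "j < m'" "\<And>i. i \<le> j \<Longrightarrow> k i = k' i"
  shows "cell X c y k m j = cell X c y k' m' j"
  using assms by (simp add: cell_def)

lemma cells_sum:
  assumes "prob_space \<mu>" and nest: "\<And>i. 1 \<le> i \<Longrightarrow> Suc i < m \<Longrightarrow> X_ge X c y i (k i) \<subseteq> X_ge X c y (Suc i) (k (Suc i))"
    and meas: "\<And>i. i < m \<Longrightarrow> X_ge X c y i (k i) \<in> sets \<mu>"
    and "n < m"
  shows "(\<Sum>j=1..n. measure \<mu> (cell X c y k m j)) = measure \<mu> (X_ge X c y n (k n))"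
  using \<open>n < m\<close>
proof (induction n)
  case 0
  then show ?case by (simp add: X_ge_def)
next
  case (Suc n)
  interpret prob_space \<mu> by fact
  have sub: "X_ge X c y n (k n) \<subseteq> X_ge X c y (Suc n) (k (Suc n))"
    using nest[of n] Suc.prems by (cases n) (auto simp: X_ge_def)
  have "measure \<mu> (cell X c y k m (Suc n)) =
     measure \<mu> (X_ge X c y (Suc n) (k (Suc n))) - measure \<mu> (X_ge X c y n (k n))"
    using Suc.prems meas[of n] meas[of "Suc n"] sub
    by (simp add: cell_def finite_measure_Diff)
  then show ?case using Suc by simp
qed

text \<open>
  The construction can be carried out for every \<open>C\<close>, so functions \<open>h\<close> with
  \<open>h_value X N y c \<mu> f C (h C)\<close> for all \<open>C\<close> exist.
\<close>

lemma h_value_exists: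
  fixes X :: "'a::euclidean_space set"
  assumes Y: "1 \<le> N"
    and c_C2: "\<forall>i\<in>{1..N}. C2_on (\<lambda>x. c x (y i)) X"
    and mu: "prob_space \<mu>" "sets \<mu> = sets (restrict_space borel X)"
    and mu_null: "\<forall>i\<in>{1..N-1}. \<forall>k. measure \<mu> (X_eq X c y i k) = 0"
    and f: "\<forall>s>0. f differentiable at s" "continuous_on {0<..} (deriv f)"
      "strictly_convex_on {0..} f"
      "filterlim (\<lambda>s. f s / s) at_top at_top"
      "filterlim (deriv f) at_bot (at_right 0)"
  shows "\<exists>r. h_value X N y c \<mu> f C r"
proof -
  have bij: "bij_betw (deriv f) {0<..} UNIV" using deriv_inv_props(1)[OF f] .
  interpret prob_space \<mu> by fact
  have spX: "space \<mu> = X"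
    using sets_eq_imp_space_eq[OF mu(2)] by (simp add: space_restrict_space)
  have g: "(\<lambda>x. c x (y (Suc i)) - c x (y i)) \<in> borel_measurable \<mu>" if "1 \<le> i" "i < N" for i
    using X_ge_measurable[of c y i X \<mu>] c_C2 mu(2) that by auto
  have meas: "X_ge X c y i l \<in> sets \<mu>" if "i < N" for i l
  proof (cases "i = 0")
    case False
    then have [measurable]: "(\<lambda>x. c x (y (Suc i)) - c x (y i)) \<in> borel_measurable \<mu>" using g that by simp
    have "{x \<in> space \<mu>. l \<le> ereal (c x (y (Suc i)) - c x (y i))} \<in> sets \<mu>" by measurable
    then show ?thesis using False by (simp add: X_ge_def spX)
  qed (simp add: X_ge_def)
  have lev: "\<exists>l<\<infinity>. measure \<mu> (X_ge X c y i l) = t" if "1 \<le> i" "i < N" "0 < t" "t \<le> 1" for i t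
    using level_ex[of \<mu> X i c y t] mu(1) spX g[of i] mu_null that by auto
  define P where "P = (\<lambda>m. 1 \<le> m \<and> m \<le> N \<and> (\<exists>kb k v. 
     v 1 = 0 \<and> (\<forall>i\<in>{2..m}. v i = v (i - 1) + k (i - 1)) \<and>
     (1 < N \<longrightarrow>
        ereal (measure \<mu> (X_ge X c y 1 (k 1))) = min 1 (deriv_inv f (ereal C - v 1))) \<and>
     (\<forall>i\<in>{2..<m}.
        ereal (measure \<mu> (X_ge X c y i (kb i))) =
          deriv_inv f (ereal C - v i) +
          ereal (\<Sum>j=1..i-1. measure \<mu> (cell X c y k m j)) \<and>
        k i = (if kb i < k_max X c y (i - 1) (k (i - 1)) then kb i
               else k_max X c y (i - 1) (k (i - 1)))) \<and>
     (\<forall>i\<in>{2..m}.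
        ereal (1 - measure \<mu> (X_ge X c y (i - 2) (k (i - 2))))
          \<ge> deriv_inv f (ereal C - v (i - 1))) \<and>
     (\<forall>i\<in>{1..N}. k i < \<infinity> \<and> v i < \<infinity>)))"
  have "P 1"
  proof -
    obtain k1 where "k1 < \<infinity>" "1 < N \<longrightarrow> ereal (measure \<mu> (X_ge X c y 1 k1)) = min 1 (deriv_inv f (ereal C))"
    proof (cases "1 < N")
      case True
      have "deriv_inv f (ereal C) > 0" using deriv_inv_pos[OF bij] by simp
      then have "0 < min 1 (deriv_inv f (ereal C))" "min 1 (deriv_inv f (ereal C)) \<le> 1"
        by (auto simp: min_def)
      then obtain t where "ereal t = min 1 (deriv_inv f (ereal C))" "0 < t" "t \<le> 1"
        by (cases "min 1 (deriv_inv f (ereal C))") auto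
      moreover obtain l where "l < \<infinity>" "measure \<mu> (X_ge X c y 1 l) = t"
        using lev[of 1 t] True calculation by auto
      ultimately show ?thesis using that[of l] by simp
    qed (use that[of 0] in simp)
    then show ?thesis using Y unfolding P_def
      by (intro conjI exI[of _ "\<lambda>_. 0::ereal"] exI[of _ "\<lambda>_. k1"] exI[of _ "\<lambda>_. 0::ereal"]) auto
  qed
  define m where "m = Greatest P"
  have bd: "q \<le> N" if "P q" for q using that unfolding P_def by simp
  have "P m" unfolding m_def using GreatestI_nat[of P 1 N] \<open>P 1\<close> bd by blast
  moreover have "\<not> P (Suc m)"
    unfolding m_def using Greatest_le_nat[of P "Suc (Greatest P)" N] bd by fastforce
  ultimately have m: "P m" "\<not> P (Suc m)" by auto
  from m(1) obtain kb k v where mN: "1 \<le> m" "m \<le> N" and v1: "v 1 = 0"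
    and v: "\<And>i. i \<in> {2..m} \<Longrightarrow> v i = v (i - 1) + k (i - 1)"
    and k1: "1 < N \<longrightarrow>
        ereal (measure \<mu> (X_ge X c y 1 (k 1))) = min 1 (deriv_inv f (ereal C - v 1))"
    and k: "\<And>i. i \<in> {2..<m} \<Longrightarrow>
        ereal (measure \<mu> (X_ge X c y i (kb i))) =
          deriv_inv f (ereal C - v i) +
          ereal (\<Sum>j=1..i-1. measure \<mu> (cell X c y k m j)) \<and>
        k i = (if kb i < k_max X c y (i - 1) (k (i - 1)) then kb i
               else k_max X c y (i - 1) (k (i - 1)))"
    and test: "\<And>i. i \<in> {2..m} \<Longrightarrow>
        ereal (1 - measure \<mu> (X_ge X c y (i - 2) (k (i - 2))))
          \<ge> deriv_inv f (ereal C - v (i - 1))"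
    and fin: "\<And>i. i \<in> {1..N} \<Longrightarrow> k i < \<infinity> \<and> v i < \<infinity>"
    unfolding P_def by blast
  have stop: "\<not> ereal (1 - measure \<mu> (X_ge X c y (m - 1) (k (m - 1))))
          \<ge> deriv_inv f (ereal C - v m)" if mltN: "m < N"
  proof
    assume T: "ereal (1 - measure \<mu> (X_ge X c y (m - 1) (k (m - 1)))) \<ge> deriv_inv f (ereal C - v m)"
    have "\<exists>b kk. kk < \<infinity> \<and> (m > 1 \<longrightarrow> ereal (measure \<mu> (X_ge X c y m b)) =
          deriv_inv f (ereal C - v m) +
          ereal (\<Sum>j=1..m-1. measure \<mu> (cell X c y k m j)) \<and>
        kk = (if b < k_max X c y (m - 1) (k (m - 1)) then b
               else k_max X c y (m - 1) (k (m - 1)))) \<and> (m = 1 \<longrightarrow> kk = k 1)"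
    proof (cases "m = 1")
      case True then show ?thesis using fin[of 1] Y by auto
    next
      case False
      have S: "(\<Sum>j=1..m-1. measure \<mu> (cell X c y k m j)) = measure \<mu> (X_ge X c y (m-1) (k (m-1)))"
      proof (rule cells_sum)
        fix i assume i: "1 \<le> i" "Suc i < m"
        then have "k (Suc i) \<le> k_max X c y i (k i)" using k[of "Suc i"] by (auto split: if_splits)
        then show "X_ge X c y i (k i) \<subseteq> X_ge X c y (Suc i) (k (Suc i))"
          using X_ge_nested[of i "k (Suc i)"] i by simp
      next
        fix i assume "i < m" then show "X_ge X c y i (k i) \<in> sets \<mu>" using meas mN by simp
      qed (use mN False mu(1) in auto)
      have pos: "deriv_inv f (ereal C - v m) > 0" 
        using deriv_inv_pos[OF bij] fin[of m] mN by (cases "v m") auto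
      then obtain t where t: "deriv_inv f (ereal C - v m) = ereal t" "t > 0"
        using T by (cases "deriv_inv f (ereal C - v m)") auto
      have "t + measure \<mu> (X_ge X c y (m-1) (k (m-1))) \<le> 1" using T t by simp
      moreover have "t + measure \<mu> (X_ge X c y (m-1) (k (m-1))) > 0" using t(2) by (simp add: add_pos_nonneg)
      ultimately obtain b where "b < \<infinity>" "measure \<mu> (X_ge X c y m b) = t + measure \<mu> (X_ge X c y (m-1) (k (m-1)))"
        using lev[of m "t + measure \<mu> (X_ge X c y (m-1) (k (m-1)))"] mN mltN
        by auto
      then show ?thesis unfolding S t(1) using False 
        by (intro exI[of _ b] exI[of _ "min b (k_max X c y (m - 1) (k (m - 1)))"]) 
          (auto simp: min_def not_less)
    qed
    then obtain b kk where b: "kk < \<infinity>" "m > 1 \<longrightarrow> ereal (measure \<mu> (X_ge X c y m b)) =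
          deriv_inv f (ereal C - v m) +
          ereal (\<Sum>j=1..m-1. measure \<mu> (cell X c y k m j)) \<and>
        kk = (if b < k_max X c y (m - 1) (k (m - 1)) then b
               else k_max X c y (m - 1) (k (m - 1)))" "m = 1 \<longrightarrow> kk = k 1" by blast
    let ?kb = "kb(m := b)" and ?k = "k(m := kk)" and ?v = "v(Suc m := v m + kk)"
    have cells: "(\<Sum>j=1..i-1. measure \<mu> (cell X c y ?k (Suc m) j)) =
      (\<Sum>j=1..i-1. measure \<mu> (cell X c y k m j))" if "i \<le> m" "i > 0" for i
      by (intro sum.cong refl arg_cong[where f = "measure \<mu>"] cell_cong) (use that in auto)
    have "P (Suc m)"
      unfolding P_def
    proof (rule conjI, use mN in simp, rule conjI, use mltN in simp, rule exI[of _ ?kb],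
        rule exI[of _ ?k], rule exI[of _ ?v], intro conjI ballI impI)
      fix i assume i: "i \<in> {2..Suc m}"
      show "?v i = ?v (i-1) + ?k (i-1)"
        using v[of i] i by (cases "i = Suc m") auto
      show "ereal (1 - measure \<mu> (X_ge X c y (i - 2) (?k (i - 2))))
          \<ge> deriv_inv f (ereal C - ?v (i - 1))"
        using test[of i] T i by (cases "i = Suc m") auto
    next
      fix i assume i: "i \<in> {2..<Suc m}"
      show "ereal (measure \<mu> (X_ge X c y i (?kb i))) =
          deriv_inv f (ereal C - ?v i) +
          ereal (\<Sum>j=1..i-1. measure \<mu> (cell X c y ?k (Suc m) j))"
        using cells[of i] k[of i] b(2) i by (cases "i = m") auto
      show "?k i = (if ?kb i < k_max X c y (i - 1) (?k (i - 1)) then ?kb i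
               else k_max X c y (i - 1) (?k (i - 1)))"
        using k[of i] b(2) i by (cases "i = m") auto
    next
      fix i assume "i \<in> {1..N}"
      then show "?k i < \<infinity>" "?v i < \<infinity>" using fin[of i] fin[of m] b(1) mN by auto
    next
      assume "1 < N"
      then show "ereal (measure \<mu> (X_ge X c y 1 (?k 1))) = min 1 (deriv_inv f (ereal C - ?v 1))"
        using k1 b(3) mN by auto
    qed (use mN that v1 in auto)
    then show False using m(2) by simp
  qed
  have "construction X N y c \<mu> f C m kb k v"
    unfolding construction_def using mN v1 v k1 k test stop by blast
  then show ?thesis unfolding h_value_def by blast
qed

end

theory Submission
  imports Defs
begin

text \<open>
  Write \<open>M i l\<close> for the mass of the superlevel set of index \<open>i\<close> at level \<open>l\<close>. It is decreasing
  in \<open>l\<close>, and the cells telescope, so the prescription for the auxiliary level reads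
  \<open>M i (kb i) = (f')\<inverse>(C - v i) + M (i - 1) (k (i - 1))\<close> for \<open>i \<ge> 2\<close>.

  Compare runs at \<open>C < C'\<close>, writing primes for the second, at an index reached by both.
  Suppose \<open>v' i \<le> v i\<close> and \<open>k' (i - 1) \<le> k (i - 1)\<close>. Then \<open>C' - v' i > C - v i\<close>, so
  neither summand on the right is smaller for \<open>C'\<close>, and the first one is larger; hence \<open>kb' i < kb i\<close>.
  The cap \<open>k_max\<close> is increasing in the previous level, and therefore \<open>k' i \<le> k i\<close> and
  \<open>v' (i + 1) \<le> v (i + 1)\<close>. By induction a larger \<open>C\<close> lowers all levels and potentials
  (\<open>construction_compare\<close>). The quantity \<open>1 - M (i - 1) (k (i - 1)) - (f')\<inverse>(C - v i)\<close>,
  whose sign decides whether the construction goes on and which is \<open>h(C)\<close> at \<open>i = N\<close>, is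
  therefore decreasing in \<open>C\<close>: if the run at \<open>C'\<close> reaches \<open>N\<close>, then so does the one at \<open>C\<close>,
  and \<open>h(C) \<ge> h(C')\<close>.

  Strictness is what makes the argument independent of the choice of levels, because
  masses determine levels only up to null sets: \<open>M i l < M i l'\<close> forces \<open>l' < l\<close>, whereas equal
  masses say nothing. Strictness is available because the potential \<open>v' i\<close> is finite before the
  last index.
\<close>

lemma deriv_inv_strict_mono:
  assumes bij: "bij_betw (deriv f) {0<..} UNIV" and sm: "strict_mono_on {0<..} (deriv f)"
    and st: "s < t"
  shows "deriv_inv f s < deriv_inv f t"
proof (cases "s = -\<infinity>")
  case True
  then show ?thesis using deriv_inv_pos[OF bij, of t] st by (auto simp: deriv_inv_def)
next
  case False
  then obtain a where a: "s = ereal a" using st by (cases s) auto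
  show ?thesis
  proof (cases "t = \<infinity>")
    case True
    then show ?thesis by (simp add: a deriv_inv_def)
  next
    case False
    then obtain b where b: "t = ereal b" using st by (cases t) auto
    let ?g = "the_inv_into {0<..} (deriv f)"
    have inj: "inj_on (deriv f) {0<..}" and im: "deriv f ` {0<..} = UNIV"
      using bij by (auto simp: bij_betw_def)
    have g: "?g r \<in> {0<..}" "deriv f (?g r) = r" for r
      using the_inv_into_into[OF inj, of r "{0<..}"] f_the_inv_into_f[OF inj, of r] im by auto
    have "\<not> ?g b \<le> ?g a"
    proof
      assume "?g b \<le> ?g a"
      then have "deriv f (?g b) \<le> deriv f (?g a)"
        using strict_mono_on_leD[OF sm g(1) g(1)] by blast
      then show False using g(2) st by (simp add: a b)
    qed
    then show ?thesis by (simp add: a b deriv_inv_def)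
  qed
qed

lemma X_ge_antimono: "l \<le> l' \<Longrightarrow> X_ge X c y i l' \<subseteq> X_ge X c y i l"
  by (auto simp: X_ge_def)

lemma k_max_mono:
  assumes "l \<le> l'"
  shows "k_max X c y i l \<le> k_max X c y i l'"
proof -
  have "X_ge X c y i l' \<subseteq> X_ge X c y i l" by (rule X_ge_antimono[OF assms])
  then have "{ereal r |r. X_ge X c y i l \<subseteq> X_ge X c y (Suc i) (ereal r)} \<subseteq>
      {ereal r |r. X_ge X c y i l' \<subseteq> X_ge X c y (Suc i) (ereal r)}"
    by (auto dest: subset_trans)
  then show ?thesis unfolding k_max_def by (rule Sup_subset_mono)
qed

lemma X_ge_sets:
  assumes C2: "C2_on (\<lambda>x. c x (y i)) X" "C2_on (\<lambda>x. c x (y (Suc i))) X"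
    and \<mu>: "sets \<mu> = sets (restrict_space borel X)"
  shows "X_ge X c y i l \<in> sets \<mu>"
proof (cases "i = 0")
  case False
  have sp: "space \<mu> = X"
    using sets_eq_imp_space_eq[OF \<mu>] by (simp add: space_restrict_space)
  have [measurable]: "(\<lambda>x. c x (y (Suc i)) - c x (y i)) \<in> borel_measurable \<mu>"
    using C2 \<mu> by (rule X_ge_measurable)
  have "{x \<in> space \<mu>. l \<le> ereal (c x (y (Suc i)) - c x (y i))} \<in> sets \<mu>"
    by measurable
  then show ?thesis using False by (simp add: X_ge_def sp)
qed (simp add: X_ge_def)

text \<open>
  The recursion for the levels with the cell masses summed up and the cap written as a minimum.
\<close>

lemma construction_level:
  assumes con: "construction X N y c \<mu> f C m kb k v"
    and \<mu>: "prob_space \<mu>" and meas: "\<And>i l. i < N \<Longrightarrow> X_ge X c y i l \<in> sets \<mu>"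
    and i: "2 \<le> i" "i < m"
  shows "ereal (measure \<mu> (X_ge X c y i (kb i))) =
      deriv_inv f (ereal C - v i) + ereal (measure \<mu> (X_ge X c y (i - 1) (k (i - 1))))"
    and "k i = min (kb i) (k_max X c y (i - 1) (k (i - 1)))"
proof -
  have mN: "m \<le> N" using con by (simp add: construction_def)
  have step: "ereal (measure \<mu> (X_ge X c y j (kb j))) = deriv_inv f (ereal C - v j) +
        ereal (\<Sum>n=1..j-1. measure \<mu> (cell X c y k m n))"
      "k j = min (kb j) (k_max X c y (j - 1) (k (j - 1)))" if "2 \<le> j" "j < m" for j
  proof -
    have "j \<in> {2..<m}" using that by simp
    then have "ereal (measure \<mu> (X_ge X c y j (kb j))) = deriv_inv f (ereal C - v j) +
          ereal (\<Sum>n=1..j-1. measure \<mu> (cell X c y k m n)) \<and>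
        k j = (if kb j < k_max X c y (j - 1) (k (j - 1)) then kb j
               else k_max X c y (j - 1) (k (j - 1)))"
      using con unfolding construction_def by blast
    then show "ereal (measure \<mu> (X_ge X c y j (kb j))) = deriv_inv f (ereal C - v j) +
        ereal (\<Sum>n=1..j-1. measure \<mu> (cell X c y k m n))"
      "k j = min (kb j) (k_max X c y (j - 1) (k (j - 1)))"
      by (auto simp: min_def)
  qed
  show "k i = min (kb i) (k_max X c y (i - 1) (k (i - 1)))" using step(2) i by simp
  have "(\<Sum>n=1..i-1. measure \<mu> (cell X c y k m n)) = measure \<mu> (X_ge X c y (i - 1) (k (i - 1)))"
  proof (rule cells_sum)
    fix j assume j: "1 \<le> j" "Suc j < m"
    then have "k (Suc j) \<le> k_max X c y j (k j)" using step(2)[of "Suc j"] by simp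
    then show "X_ge X c y j (k j) \<subseteq> X_ge X c y (Suc j) (k (Suc j))"
      using j by (intro X_ge_nested) auto
  qed (use \<mu> meas i mN in auto)
  then show "ereal (measure \<mu> (X_ge X c y i (kb i))) =
      deriv_inv f (ereal C - v i) + ereal (measure \<mu> (X_ge X c y (i - 1) (k (i - 1))))"
    using step(1) i by simp
qed

text \<open>
  If the run at the larger constant goes at least as far as the other one, then its potentials
  and levels are no higher at every index reached by both. The induction proves this and the
  conclusions record what it means for the two terms of the stopping test.
\<close>

lemma construction_compare:
  assumes con: "construction X N y c \<mu> f C m kb k v"
    and con': "construction X N y c \<mu> f C' m' kb' k' v'"
    and "C < C'" "m \<le> m'"
    and \<mu>: "prob_space \<mu>" and meas: "\<And>i l. i < N \<Longrightarrow> X_ge X c y i l \<in> sets \<mu>"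
    and bij: "bij_betw (deriv f) {0<..} UNIV" and sm: "strict_mono_on {0<..} (deriv f)"
    and i: "1 \<le> i" "i \<le> m"
  shows "deriv_inv f (ereal C - v i) \<le> deriv_inv f (ereal C' - v' i)"
    and "measure \<mu> (X_ge X c y (i - 1) (k (i - 1))) \<le> measure \<mu> (X_ge X c y (i - 1) (k' (i - 1)))"
proof -
  interpret prob_space \<mu> by fact
  let ?\<phi> = "deriv_inv f" and ?M = "\<lambda>i l. measure \<mu> (X_ge X c y i l)"
  have mN: "m \<le> N" "m' \<le> N" using con con' by (auto simp: construction_def)
  have M_mono: "?M j l \<le> ?M j l'" if "l' \<le> l" "j < N" for j l l'
    using finite_measure_mono[OF X_ge_antimono[OF that(1)] meas[OF that(2)]] .
  then have M_less: "l' < l" if "?M j l < ?M j l'" "j < N" for j l l'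
    using that by (meson not_le)
  have M_top: "l < \<infinity>" if "0 < ?M j l" for j l
    using that by (cases "l = \<infinity>") (auto simp: X_ge_def split: if_splits)
  have test': "?\<phi> (ereal C' - v' j) \<le> ereal (1 - ?M (j - 1) (k' (j - 1)))" if "1 \<le> j" "j < m'" for j
  proof -
    have "Suc j \<in> {2..m'}" using that by auto
    then have "?\<phi> (ereal C' - v' (Suc j - 1)) \<le> ereal (1 - ?M (Suc j - 2) (k' (Suc j - 2)))"
      using con' unfolding construction_def by blast
    moreover have "Suc j - 2 = j - 1" by simp
    ultimately show ?thesis by simp
  qed
  have vSuc: "v (Suc j) = v j + k j" if "1 \<le> j" "j < m" for j
  proof -
    have "Suc j \<in> {2..m}" using that by auto
    then show ?thesis using con unfolding construction_def by fastforce
  qed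
  have vSuc': "v' (Suc j) = v' j + k' j" if "1 \<le> j" "j < m'" for j
  proof -
    have "Suc j \<in> {2..m'}" using that by auto
    then show ?thesis using con' unfolding construction_def by fastforce
  qed
  have *: "v' i \<le> v i \<and> v' i < \<infinity> \<and> (2 \<le> i \<longrightarrow> k' (i - 1) \<le> k (i - 1))"
    using i
  proof (induction i rule: nat_induct_at_least)
    case base
    then show ?case using con con' by (simp add: construction_def)
  next
    case (Suc j)
    then have j: "1 \<le> j" "j < m" "j < m'" "j < N" using \<open>m \<le> m'\<close> mN by auto
    have IH: "v' j \<le> v j" "v' j < \<infinity>" "2 \<le> j \<Longrightarrow> k' (j - 1) \<le> k (j - 1)"
      using Suc j by auto
    \<comment> \<open>the stopping test is passed at \<open>Suc j\<close>, which bounds the inverse of the derivative by 1\<close>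
    have "?\<phi> (ereal C' - v' j) \<noteq> \<infinity>" using test'[of j] j by auto
    then have "v' j \<noteq> -\<infinity>" by (auto simp: deriv_inv_def)
    then obtain r where r: "v' j = ereal r" using IH by (cases "v' j") auto
    have "ereal C - v j < ereal C' - v' j"
      using IH(1) \<open>C < C'\<close> r by (cases "v j") auto
    then have \<phi>: "?\<phi> (ereal C - v j) < ?\<phi> (ereal C' - v' j)"
      by (rule deriv_inv_strict_mono[OF bij sm])
    have pos: "0 < ?\<phi> (ereal C' - v' j)" using r by (intro deriv_inv_pos[OF bij]) simp
    have "k' j \<le> k j \<and> k' j < \<infinity>"
    proof (cases "j = 1")
      case True
      \<comment> \<open>so the truncation at 1 in the first level is not active for \<open>C'\<close>, and strictness survives\<close>
      have "?\<phi> (ereal C' - v' 1) \<le> 1"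
        using test'[of 1] True j by (simp add: X_ge_def one_ereal_def)
      moreover have "ereal (?M 1 (k 1)) = min 1 (?\<phi> (ereal C - v 1))"
        "ereal (?M 1 (k' 1)) = min 1 (?\<phi> (ereal C' - v' 1))"
        using con con' j unfolding construction_def by auto
      ultimately have "ereal (?M 1 (k 1)) < ereal (?M 1 (k' 1))" "0 < ereal (?M 1 (k' 1))"
        using \<phi> pos True by (auto simp: min_def)
      then have "?M 1 (k 1) < ?M 1 (k' 1)" "0 < ?M 1 (k' 1)" by simp_all
      then have "k' 1 < k 1" "k' 1 < \<infinity>" using True j M_less M_top by blast+
      then show ?thesis using True by simp
    next
      case False
      then have j2: "2 \<le> j" using j by simp
      have lev: "ereal (?M j (kb j)) = ?\<phi> (ereal C - v j) + ereal (?M (j - 1) (k (j - 1)))"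
        "k j = min (kb j) (k_max X c y (j - 1) (k (j - 1)))"
        using construction_level[OF con \<mu> meas j2 j(2)] by blast+
      have lev': "ereal (?M j (kb' j)) = ?\<phi> (ereal C' - v' j) + ereal (?M (j - 1) (k' (j - 1)))"
        "k' j = min (kb' j) (k_max X c y (j - 1) (k' (j - 1)))"
        using construction_level[OF con' \<mu> meas j2 j(3)] by blast+
      have "?M (j - 1) (k (j - 1)) \<le> ?M (j - 1) (k' (j - 1))"
        using IH(3) j2 j by (intro M_mono) auto
      then have "?\<phi> (ereal C - v j) + ereal (?M (j - 1) (k (j - 1))) <
          ?\<phi> (ereal C' - v' j) + ereal (?M (j - 1) (k' (j - 1)))"
        using \<phi> ereal_add_strict_mono[of "ereal (?M (j - 1) (k (j - 1)))"
            "ereal (?M (j - 1) (k' (j - 1)))" "?\<phi> (ereal C - v j)" "?\<phi> (ereal C' - v' j)"]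
        by (simp add: add.commute)
      then have "?M j (kb j) < ?M j (kb' j)" using lev(1) lev'(1) by (metis less_ereal.simps(1))
      then have kb: "kb' j < kb j" using j M_less by blast
      moreover have "k_max X c y (j - 1) (k' (j - 1)) \<le> k_max X c y (j - 1) (k (j - 1))"
        using IH(3) j2 by (intro k_max_mono) auto
      ultimately have "k' j \<le> k j" unfolding lev(2) lev'(2) by (intro min.mono) auto
      moreover have "k' j \<le> kb' j" unfolding lev'(2) by simp
      ultimately show ?thesis using kb by auto
    qed
    then show ?case using vSuc[of j] vSuc'[of j] j IH by (auto intro: add_mono)
  qed
  have "ereal C - v i \<le> ereal C' - v' i" using * \<open>C < C'\<close> by (intro ereal_minus_mono) auto
  then show "?\<phi> (ereal C - v i) \<le> ?\<phi> (ereal C' - v' i)"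
    using deriv_inv_strict_mono[OF bij sm] by (metis order_le_less)
  show "?M (i - 1) (k (i - 1)) \<le> ?M (i - 1) (k' (i - 1))"
  proof (cases "2 \<le> i")
    case True
    then show ?thesis using * i mN by (intro M_mono) auto
  next
    case False
    then show ?thesis using i by (simp add: X_ge_def)
  qed
qed

theorem lemmaB2:
  fixes X :: "'a::euclidean_space set"
    and N :: nat
    and y :: "nat \<Rightarrow> real"
    and c :: "'a \<Rightarrow> real \<Rightarrow> real"
    and \<mu> :: "'a measure"
    and f :: "real \<Rightarrow> real"
    and h :: "real \<Rightarrow> ereal"
  assumes X: "open X" "bounded X"
    and Y: "1 \<le> N" "inj_on y {1..N}"
    and c_C2: "\<forall>i\<in>{1..N}. C2_on (\<lambda>x. c x (y i)) X"
    and c_nondeg: "\<forall>x\<in>X. \<forall>i\<in>{1..N-1}.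
        (\<lambda>w. frechet_derivative (\<lambda>z. c z (y (Suc i))) (at x) w
             - frechet_derivative (\<lambda>z. c z (y i)) (at x) w) \<noteq> (\<lambda>w. 0)"
    and mu: "prob_space \<mu>" "sets \<mu> = sets (restrict_space borel X)"
    and mu_null: "\<forall>i\<in>{1..N-1}. \<forall>k. measure \<mu> (X_eq X c y i k) = 0"
    and f_diff: "\<forall>s>0. f differentiable at s" "continuous_on {0<..} (deriv f)"
    and f_convex: "strictly_convex_on {0..} f"
    and f_superlinear: "filterlim (\<lambda>s. f s / s) at_top at_top"
    and f_deriv_0: "filterlim (deriv f) at_bot (at_right 0)"
    and h: "\<forall>C. h_value X N y c \<mu> f C (h C)"
  shows "\<forall>C C'. C < C' \<longrightarrow> h C \<ge> h C'"
proof (intro allI impI)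
  fix C C' :: real assume "C < C'"
  note deriv = deriv_inv_props[OF f_diff f_convex f_superlinear f_deriv_0]
  have meas: "X_ge X c y i l \<in> sets \<mu>" if "i < N" for i l
  proof (cases "i = 0")
    case False
    then show ?thesis using X_ge_sets[of c y i X \<mu> l] c_C2 mu(2) that by auto
  qed (simp add: X_ge_def)
  let ?\<phi> = "deriv_inv f" and ?M = "\<lambda>i l. measure \<mu> (X_ge X c y i l)"
  obtain m kb k v where con: "construction X N y c \<mu> f C m kb k v"
    and hC: "h C = (if m < N then -\<infinity> else ereal (1 - ?M (N - 1) (k (N - 1))) - ?\<phi> (ereal C - v N))"
    using h unfolding h_value_def by blast
  obtain m' kb' k' v' where con': "construction X N y c \<mu> f C' m' kb' k' v'"
    and hC': "h C' =
      (if m' < N then -\<infinity> else ereal (1 - ?M (N - 1) (k' (N - 1))) - ?\<phi> (ereal C' - v' N))"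
    using h unfolding h_value_def by blast
  show "h C \<ge> h C'"
  proof (cases "m' < N")
    case False
    have m: "1 \<le> m" "m \<le> N" "m' = N" using con con' False by (auto simp: construction_def)
    then have "m \<le> m'" by simp
    note cmp = construction_compare[OF con con' \<open>C < C'\<close> this mu(1) meas deriv m(1) order_refl]
    have "m = N"
    proof (rule ccontr)
      assume "m \<noteq> N"
      then have "Suc m \<in> {2..m'}" "m < N" using m by auto
      then have "?\<phi> (ereal C' - v' (Suc m - 1)) \<le> ereal (1 - ?M (Suc m - 2) (k' (Suc m - 2)))"
        and fail: "\<not> ?\<phi> (ereal C - v m) \<le> ereal (1 - ?M (m - 1) (k (m - 1)))"
        using con con' unfolding construction_def by blast+
      moreover have "Suc m - 2 = m - 1" by simp
      ultimately have "?\<phi> (ereal C' - v' m) \<le> ereal (1 - ?M (m - 1) (k' (m - 1)))" by simp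
      also have "\<dots> \<le> ereal (1 - ?M (m - 1) (k (m - 1)))" using cmp(2) by simp
      finally show False using order_trans[OF cmp(1)] fail by blast
    qed
    then have "h C = ereal (1 - ?M (m - 1) (k (m - 1))) - ?\<phi> (ereal C - v m)"
      "h C' = ereal (1 - ?M (m - 1) (k' (m - 1))) - ?\<phi> (ereal C' - v' m)"
      using hC hC' m(3) by auto
    moreover have "ereal (1 - ?M (m - 1) (k' (m - 1))) \<le> ereal (1 - ?M (m - 1) (k (m - 1)))"
      using cmp(2) by simp
    ultimately show ?thesis using cmp(1) by (simp only: ereal_minus_mono)
  qed (simp add: hC')
qed

end
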